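(* Let $N\in\mathbb N$, and let $P_N$ be the space of homogeneous polynomials of total degree $N$ in $P=\mathbb C[x,y,z,w]$, regarded as an $\mathfrak{sl}_4(\mathbb C)$-module. The following hold. (i) $P_N$ has a basis $$A_1^sA_2^tA_3^u\,x^N\qquad s,t,u\in\mathbb N,\quad s+t+u\le N.$$ (ii) $P_N$ has a basis $$A_1^{*s}A_2^{*t}A_3^{*u}\,x^{*N}\qquad s,t,u\in\mathbb N,\quad s+t+u\le N.$$
   Context: $\mathbb N=\{0,1,2,\ldots\}$. With $E_{a,b}$ the $4\times4$ matrix units, define in $\mathfrak{sl}_4(\mathbb C)$: $A_1=E_{12}+E_{21}+E_{34}+E_{43}$, $A_2=E_{13}+E_{31}+E_{24}+E_{42}$, $A_3=E_{14}+E_{41}+E_{23}+E_{32}$, $A_1^*={\rm diag}(1,1,-1,-1)$, $A_2^*={\rm diag}(1,-1,1,-1)$, $A_3^*={\rm diag}(1,-1,-1,1)$. $P=\mathbb C[x,y,z,w]$ is an $\mathfrak{sl}_4(\mathbb C)$-module on which every element acts as a derivation, and on the degree-one part $\varphi\in\mathfrak{sl}_4(\mathbb C)$ acts by its matrix with respect to the ordered basis $(v_1,v_2,v_3,v_4)=(x,y,z,w)$, i.e. $\varphi v_b=\sum_a\varphi_{ab}v_a$. $P_N$ is a submodule. Products and powers of the $A_i,A_i^*$ denote compositions of their actions on $P$. $x^*=\frac{x+y+z+w}2$. *)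

theory Defs
  imports "HOL-Analysis.Determinants" "HOL-Library.Poly_Mapping"
begin

section \<open>The polynomial ring in four variables\<close>

text \<open>
  The variables \<open>x, y, z, w\<close> are indexed by the numeral type \<open>4\<close>, whose elements are
  \<open>1, 2, 3\<close> and \<open>4 = 0\<close>. A monomial is its exponent function; the product of
  \<^typ>\<open>(4 \<Rightarrow>\<^sub>0 nat) \<Rightarrow>\<^sub>0 complex\<close> is convolution, i.e. polynomial multiplication.
\<close>

type_synonym pol = "(4 \<Rightarrow>\<^sub>0 nat) \<Rightarrow>\<^sub>0 complex"

definition var :: "4 \<Rightarrow> pol" where
  "var i = Poly_Mapping.single (Poly_Mapping.single i 1) 1"

definition pscale :: "complex \<Rightarrow> pol \<Rightarrow> pol" where
  "pscale c p = Poly_Mapping.map ((*) c) p"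

lemma pscale_conv_mult: "pscale c p = Poly_Mapping.single 0 c * p"
  by (simp add: pscale_def mult_map_scale_conv_mult)

lemma lookup_pscale [simp]:
  "Poly_Mapping.lookup (pscale c p) m = c * Poly_Mapping.lookup p m"
  by (simp add: pscale_def Poly_Mapping.map.rep_eq when_def)

lemma vector_space_pscale: "vector_space pscale"
  by unfold_locales (auto intro!: poly_mapping_eqI simp: lookup_add algebra_simps)

definition mdeg :: "(4 \<Rightarrow>\<^sub>0 nat) \<Rightarrow> nat" where
  "mdeg m = (\<Sum>i\<in>UNIV. Poly_Mapping.lookup m i)"

text \<open>\<open>homog N\<close> is the space \<open>P\<^sub>N\<close>; it contains \<open>0\<close>.\<close>

definition homog :: "nat \<Rightarrow> pol set" where
  "homog N = {p. \<forall>m \<in> Poly_Mapping.keys p. mdeg m = N}"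

lemma subspace_homog: "module.subspace pscale (homog N)"
proof -
  interpret vector_space pscale by (rule vector_space_pscale)
  show ?thesis
  proof (rule subspaceI)
    show "0 \<in> homog N" by (simp add: homog_def)
    show "x + y \<in> homog N" if "x \<in> homog N" "y \<in> homog N" for x y
      using that keys_add[of x y] by (auto simp: homog_def)
    show "pscale c x \<in> homog N" if "x \<in> homog N" for c x
      using that by (auto simp: homog_def in_keys_iff)
  qed
qed

section \<open>The action of \<open>sl\<^sub>4\<close>\<close>

definition sl4 :: "(complex^4^4) set" where
  "sl4 = {\<phi>. trace \<phi> = 0}"

definition pdiff :: "4 \<Rightarrow> pol \<Rightarrow> pol" where
  "pdiff b p = (\<Sum>m\<in>Poly_Mapping.keys p.
     Poly_Mapping.single (m - Poly_Mapping.single b 1)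
       (of_nat (Poly_Mapping.lookup m b) * Poly_Mapping.lookup p m))"

definition matvar :: "complex^4^4 \<Rightarrow> 4 \<Rightarrow> pol" where
  "matvar \<phi> b = (\<Sum>a\<in>UNIV. pscale (\<phi> $ a $ b) (var a))"

text \<open>
  The derivation of the polynomial ring that sends \<open>v\<^sub>b\<close> to \<open>\<Sum>\<^sub>a \<phi>\<^sub>a\<^sub>b v\<^sub>a\<close>. The lemmas
  \<open>derivation_act\<close>, \<open>act_var\<close> and \<open>act_unique\<close> below show that it is the only one, and
  \<open>act_bracket\<close> that the action is compatible with the Lie bracket.
\<close>

definition act :: "complex^4^4 \<Rightarrow> pol \<Rightarrow> pol" where
  "act \<phi> p = (\<Sum>b\<in>UNIV. matvar \<phi> b * pdiff b p)"

definition derivation :: "(pol \<Rightarrow> pol) \<Rightarrow> bool" where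
  "derivation D \<longleftrightarrow>
     (\<forall>p q. D (p + q) = D p + D q) \<and>
     (\<forall>c p. D (pscale c p) = pscale c (D p)) \<and>
     (\<forall>p q. D (p * q) = D p * q + p * D q)"

lemma pol_expand:
  fixes p :: "'a \<Rightarrow>\<^sub>0 'b::comm_monoid_add"
  shows "p = (\<Sum>m\<in>Poly_Mapping.keys p. Poly_Mapping.single m (Poly_Mapping.lookup p m))"
  by (rule poly_mapping_eqI)
    (auto simp: lookup_sum lookup_single when_def in_keys_iff)

lemma pol_induct [case_names zero single add]:
  fixes p :: "'a \<Rightarrow>\<^sub>0 'b::comm_monoid_add"
  assumes "P 0" "\<And>m c. P (Poly_Mapping.single m c)" "\<And>p q. P p \<Longrightarrow> P q \<Longrightarrow> P (p + q)"
  shows "P p"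
proof -
  have "P (\<Sum>m\<in>K. Poly_Mapping.single m (Poly_Mapping.lookup p m))" for K
    by (induction K rule: infinite_finite_induct) (auto intro: assms)
  then show ?thesis by (subst pol_expand)
qed

lemma pdiff_superset:
  assumes "finite K" "Poly_Mapping.keys p \<subseteq> K"
  shows "pdiff b p = (\<Sum>m\<in>K. Poly_Mapping.single (m - Poly_Mapping.single b 1)
       (of_nat (Poly_Mapping.lookup m b) * Poly_Mapping.lookup p m))"
  unfolding pdiff_def using assms
  by (intro sum.mono_neutral_left) (auto simp: in_keys_iff)

lemma pdiff_add: "pdiff b (p + q) = pdiff b p + pdiff b q"
proof -
  let ?K = "Poly_Mapping.keys p \<union> Poly_Mapping.keys q"
  have "Poly_Mapping.keys (p + q) \<subseteq> ?K" by (rule keys_add)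
  then show ?thesis
    by (simp add: pdiff_superset[of ?K] lookup_add distrib_left single_add sum.distrib)
qed

lemma pdiff_0 [simp]: "pdiff b 0 = 0"
  by (simp add: pdiff_def)

lemma pdiff_single:
  "pdiff b (Poly_Mapping.single m c) =
     Poly_Mapping.single (m - Poly_Mapping.single b 1) (of_nat (Poly_Mapping.lookup m b) * c)"
  by (subst pdiff_superset[of "{m}"]) (auto split: if_splits)

lemma single_split:
  fixes m :: "4 \<Rightarrow>\<^sub>0 nat"
  assumes "Poly_Mapping.lookup m b \<noteq> 0"
  shows "m + n - Poly_Mapping.single b 1 = (m - Poly_Mapping.single b 1) + n"
  using assms by (intro poly_mapping_eqI) (auto simp: lookup_add lookup_minus lookup_single when_def)

lemma pdiff_mult_single:
  fixes m n :: "4 \<Rightarrow>\<^sub>0 nat"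
  shows "pdiff b (Poly_Mapping.single m c * Poly_Mapping.single n d) =
     pdiff b (Poly_Mapping.single m c) * Poly_Mapping.single n d
     + Poly_Mapping.single m c * pdiff b (Poly_Mapping.single n d)"
proof -
  let ?e = "Poly_Mapping.single b (1::nat)"
  have 1: "Poly_Mapping.single (m + n - ?e) (of_nat (Poly_Mapping.lookup m b) * (c * d)) =
      Poly_Mapping.single ((m - ?e) + n) (of_nat (Poly_Mapping.lookup m b) * (c * d))"
    using single_split[of m b n] by (cases "Poly_Mapping.lookup m b = 0") auto
  have 2: "Poly_Mapping.single (m + n - ?e) (of_nat (Poly_Mapping.lookup n b) * (c * d)) =
      Poly_Mapping.single (m + (n - ?e)) (of_nat (Poly_Mapping.lookup n b) * (c * d))"
    using single_split[of n b m] by (cases "Poly_Mapping.lookup n b = 0") (auto simp: add.commute)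
  show ?thesis
    by (simp only: mult_single pdiff_single lookup_add of_nat_add distrib_right single_add 1 2)
      (simp add: algebra_simps)
qed

lemma pdiff_mult: "pdiff b (p * q) = pdiff b p * q + p * pdiff b q"
proof (induction p rule: pol_induct)
  case (single m c)
  show ?case
  proof (induction q rule: pol_induct)
    case (single n d)
    show ?case by (rule pdiff_mult_single)
  qed (auto simp: pdiff_add algebra_simps)
qed (auto simp: pdiff_add algebra_simps)

lemma pdiff_pscale: "pdiff b (pscale c p) = pscale c (pdiff b p)"
  by (simp add: pscale_conv_mult pdiff_mult pdiff_single)

lemma pdiff_var: "pdiff b (var a) = (if a = b then 1 else 0)"
  by (auto simp: var_def pdiff_single lookup_single when_def)

lemma derivation_act: "derivation (act \<phi>)"
proof -
  have "act \<phi> (p + q) = act \<phi> p + act \<phi> q" for p q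
    by (simp add: act_def pdiff_add distrib_left sum.distrib)
  moreover have "act \<phi> (pscale c p) = pscale c (act \<phi> p)" for c p
    unfolding act_def pdiff_pscale
    unfolding pscale_conv_mult sum_distrib_left by (simp only: mult.left_commute)
  moreover have "act \<phi> (p * q) = act \<phi> p * q + p * act \<phi> q" for p q
    unfolding act_def pdiff_mult sum_distrib_left sum_distrib_right distrib_left sum.distrib
    by (simp only: mult.left_commute[of p] mult.assoc)
  ultimately show ?thesis by (simp add: derivation_def)
qed

lemma act_var: "act \<phi> (var b) = (\<Sum>a\<in>UNIV. pscale (\<phi> $ a $ b) (var a))"
  by (simp add: act_def pdiff_var matvar_def if_distrib cong: if_cong)

lemma derivationD:
  assumes "derivation D"
  shows "D (p + q) = D p + D q" "D (pscale c p) = pscale c (D p)" "D (p * q) = D p * q + p * D q"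
    and "D 0 = 0" "D 1 = 0"
proof -
  show add: "D (p + q) = D p + D q" and "D (pscale c p) = pscale c (D p)"
    and mult: "D (p * q) = D p * q + p * D q" for p q c
    using assms unfolding derivation_def by blast+
  show "D 0 = 0" using add[of 0 0] by simp
  show "D 1 = 0" using mult[of 1 1] by simp
qed

lemma derivation_unique:
  assumes D: "derivation D" and D': "derivation D'" and v: "\<And>b. D (var b) = D' (var b)"
  shows "D p = D' p"
proof (induction p rule: pol_induct)
  case zero
  show ?case by (simp add: derivationD[OF D] derivationD[OF D'])
next
  case (add p q)
  then show ?case by (simp add: derivationD(1)[OF D] derivationD(1)[OF D'])
next
  case (single m c)
  have pow: "D (Poly_Mapping.single (Poly_Mapping.single i k) 1) =
      D' (Poly_Mapping.single (Poly_Mapping.single i k) 1)" for i k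
  proof (induction k)
    case 0
    show ?case by (simp add: derivationD[OF D] derivationD[OF D'])
  next
    case (Suc k)
    have eq: "Poly_Mapping.single (Poly_Mapping.single i (Suc k)) (1::complex) =
        var i * Poly_Mapping.single (Poly_Mapping.single i k) 1"
      by (simp add: var_def mult_single flip: single_add)
    show ?case
      unfolding eq derivationD(3)[OF D] derivationD(3)[OF D'] by (simp only: v Suc)
  qed
  have "D (Poly_Mapping.single m 1) = D' (Poly_Mapping.single m 1)"
  proof (induction m rule: pol_induct)
    case zero
    show ?case by (simp add: derivationD[OF D] derivationD[OF D'])
  next
    case (single i k)
    show ?case by (rule pow)
  next
    case (add m n)
    have eq: "Poly_Mapping.single (m + n) (1::complex) =
        Poly_Mapping.single m 1 * Poly_Mapping.single n 1"
      by (simp add: mult_single)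
    show ?case
      unfolding eq derivationD(3)[OF D] derivationD(3)[OF D'] by (simp only: add)
  qed
  moreover have eq: "Poly_Mapping.single m c = pscale c (Poly_Mapping.single m 1)"
    by (simp add: pscale_conv_mult mult_single)
  ultimately show ?case
    unfolding eq derivationD(2)[OF D] derivationD(2)[OF D'] by (simp only:)
qed

lemma act_unique:
  assumes "derivation D" "\<And>b. D (var b) = (\<Sum>a\<in>UNIV. pscale (\<phi> $ a $ b) (var a))"
  shows "D = act \<phi>"
proof
  show "D p = act \<phi> p" for p
    by (rule derivation_unique[OF assms(1) derivation_act]) (simp only: assms(2) act_var)
qed

lemma act_add: "act \<phi> (p + q) = act \<phi> p + act \<phi> q"
  and act_pscale: "act \<phi> (pscale c p) = pscale c (act \<phi> p)"
  and act_mult: "act \<phi> (p * q) = act \<phi> p * q + p * act \<phi> q"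
  using derivation_act[of \<phi>] unfolding derivation_def by blast+

lemma act_zero [simp]: "act \<phi> 0 = 0"
  by (simp add: act_def)

lemma act_sum: "act \<phi> (\<Sum>i\<in>I. f i) = (\<Sum>i\<in>I. act \<phi> (f i))"
  by (induction I rule: infinite_finite_induct) (auto simp: act_add)

lemma pscale_simps:
  "pscale c (p + q) = pscale c p + pscale c q"
  "pscale c (p - q) = pscale c p - pscale c q"
  "pscale (c + d) p = pscale c p + pscale d p"
  "pscale (c - d) p = pscale c p - pscale d p"
  "pscale c (pscale d p) = pscale (c * d) p"
  by (auto intro!: poly_mapping_eqI simp: lookup_add lookup_minus algebra_simps)

lemma pscale_sum: "pscale c (\<Sum>i\<in>I. f i) = (\<Sum>i\<in>I. pscale c (f i))"
  "pscale (\<Sum>i\<in>I. g i) p = (\<Sum>i\<in>I. pscale (g i) p)"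
  by (auto intro!: poly_mapping_eqI simp: lookup_sum sum_distrib_left sum_distrib_right)

lemma pscale_mult_left: "pscale c p * q = pscale c (p * q)"
  by (simp add: pscale_conv_mult mult.assoc)

lemma act_add_left: "act (\<phi> + \<psi>) p = act \<phi> p + act \<psi> p"
  by (simp add: act_def matvar_def pscale_simps sum.distrib distrib_right)

lemma act_scale_left: "act (\<chi> i j. c * \<phi> $ i $ j) p = pscale c (act \<phi> p)"
proof -
  have "matvar (\<chi> i j. c * \<phi> $ i $ j) b = pscale c (matvar \<phi> b)" for b
    by (simp add: matvar_def pscale_sum pscale_simps)
  then show ?thesis by (simp add: act_def pscale_mult_left pscale_sum)
qed

lemma act_act_var: "act \<phi> (act \<psi> (var b)) = act (\<phi> ** \<psi>) (var b)"
proof -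
  have "act \<phi> (act \<psi> (var b)) =
      (\<Sum>a\<in>UNIV. \<Sum>k\<in>UNIV. pscale (\<psi> $ a $ b * \<phi> $ k $ a) (var k))"
    by (simp add: act_var act_sum act_pscale pscale_sum pscale_simps)
  also have "\<dots> = (\<Sum>k\<in>UNIV. \<Sum>a\<in>UNIV. pscale (\<psi> $ a $ b * \<phi> $ k $ a) (var k))"
    by (rule sum.swap)
  finally show ?thesis
    by (simp add: act_var matrix_matrix_mult_def pscale_sum mult.commute)
qed

lemma act_bracket:
  "act (\<phi> ** \<psi> - \<psi> ** \<phi>) p = act \<phi> (act \<psi> p) - act \<psi> (act \<phi> p)"
proof -
  have "derivation (\<lambda>p. act \<phi> (act \<psi> p) - act \<psi> (act \<phi> p))"
    by (simp add: derivation_def act_add act_pscale act_mult pscale_simps algebra_simps)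
  with derivation_act show ?thesis
  proof (rule derivation_unique)
    show "act (\<phi> ** \<psi> - \<psi> ** \<phi>) (var b) =
        act \<phi> (act \<psi> (var b)) - act \<psi> (act \<phi> (var b))" for b
      unfolding act_act_var by (simp add: act_var pscale_simps sum_subtractf)
  qed
qed

lemma act_homog:
  assumes "p \<in> homog N"
  shows "act \<phi> p \<in> homog N"
proof -
  interpret vector_space pscale by (rule vector_space_pscale)
  have *: "var a * Poly_Mapping.single (m - Poly_Mapping.single b 1)
      (of_nat (Poly_Mapping.lookup m b) * c) \<in> homog N" if "mdeg m = N" for a b m c
  proof (cases "Poly_Mapping.lookup m b = 0")
    case True
    then show ?thesis by (simp add: homog_def)
  next
    case False
    have m: "m = (m - Poly_Mapping.single b 1) + Poly_Mapping.single b 1"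
      using False
      by (intro poly_mapping_eqI) (auto simp: lookup_add lookup_minus lookup_single when_def)
    have add: "mdeg (k + l) = mdeg k + mdeg l" for k l
      by (simp add: mdeg_def lookup_add sum.distrib)
    have one: "mdeg (Poly_Mapping.single i 1) = 1" for i
      by (simp add: mdeg_def lookup_single when_def)
    have "mdeg m = mdeg (m - Poly_Mapping.single b 1) + 1"
      using arg_cong[OF m, of mdeg] unfolding add one .
    then have "mdeg (Poly_Mapping.single a 1 + (m - Poly_Mapping.single b 1)) = N"
      using that by (simp only: add one)
    then show ?thesis
      by (auto simp: homog_def var_def mult_single split: if_splits)
  qed
  have "act \<phi> p = (\<Sum>b\<in>UNIV. \<Sum>m\<in>Poly_Mapping.keys p. \<Sum>a\<in>UNIV. pscale (\<phi> $ a $ b)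
     (var a * Poly_Mapping.single (m - Poly_Mapping.single b 1)
       (of_nat (Poly_Mapping.lookup m b) * Poly_Mapping.lookup p m)))"
    by (simp add: act_def matvar_def pdiff_def sum_distrib_left sum_distrib_right
        pscale_conv_mult mult.assoc)
  also have "\<dots> \<in> homog N"
    using assms by (intro subspace_sum[OF subspace_homog] subspace_scale[OF subspace_homog] *)
      (auto simp: homog_def)
  finally show ?thesis .
qed

section \<open>The elements \<open>A\<^sub>i\<close> and \<open>A\<^sub>i\<^sup>*\<close>\<close>

definition munit :: "4 \<Rightarrow> 4 \<Rightarrow> complex^4^4" where
  "munit a b = (\<chi> i j. if i = a \<and> j = b then 1 else 0)"

definition diag4 :: "complex \<Rightarrow> complex \<Rightarrow> complex \<Rightarrow> complex \<Rightarrow> complex^4^4" where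
  "diag4 d1 d2 d3 d4 = (\<chi> i j. if i \<noteq> j then 0 else
     if i = 1 then d1 else if i = 2 then d2 else if i = 3 then d3 else d4)"

definition A1 :: "complex^4^4" where "A1 = munit 1 2 + munit 2 1 + munit 3 4 + munit 4 3"
definition A2 :: "complex^4^4" where "A2 = munit 1 3 + munit 3 1 + munit 2 4 + munit 4 2"
definition A3 :: "complex^4^4" where "A3 = munit 1 4 + munit 4 1 + munit 2 3 + munit 3 2"

definition A1s :: "complex^4^4" where "A1s = diag4 1 1 (-1) (-1)"
definition A2s :: "complex^4^4" where "A2s = diag4 1 (-1) 1 (-1)"
definition A3s :: "complex^4^4" where "A3s = diag4 1 (-1) (-1) 1"

lemma A_in_sl4: "A1 \<in> sl4" "A2 \<in> sl4" "A3 \<in> sl4" "A1s \<in> sl4" "A2s \<in> sl4" "A3s \<in> sl4"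
  by (simp_all add: sl4_def trace_def sum_4 A1_def A2_def A3_def A1s_def A2s_def A3s_def
      munit_def diag4_def)

definition xvar :: pol where "xvar = var 1"
definition yvar :: pol where "yvar = var 2"
definition zvar :: pol where "zvar = var 3"
definition wvar :: pol where "wvar = var 4"

definition xstar :: pol where
  "xstar = pscale (1/2) (xvar + yvar + zvar + wvar)"

section \<open>Bases given as indexed families\<close>

text \<open>Injectivity makes this linear independence of the family, not just of its set of values.\<close>

definition family_basis :: "('i \<Rightarrow> pol) \<Rightarrow> 'i set \<Rightarrow> pol set \<Rightarrow> bool" where
  "family_basis f I V \<longleftrightarrow>
     inj_on f I \<and> \<not> module.dependent pscale (f ` I) \<and> module.span pscale (f ` I) = V"

end

theory Submission
  imports Defs
begin

text \<open>
  Let \<open>v\<^sub>1, \<dots>, v\<^sub>4\<close> be linear forms spanning \<open>P\<^sub>1\<close> that are permuted by three elements of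
  \<open>sl\<^sub>4\<close>, the \<open>k\<close>-th of which sends \<open>v\<^sub>1\<close> to \<open>v\<^sub>k\<^sub>+\<^sub>1\<close>. Filter \<open>P\<^sub>N\<close> by the exponent of \<open>v\<^sub>1\<close> in
  monomials in the \<open>v\<^sub>i\<close>. Each of the three derivations lowers this exponent by at most one, and
  does so only in the term that replaces a factor \<open>v\<^sub>1\<close> by \<open>v\<^sub>k\<^sub>+\<^sub>1\<close>. So the vector indexed by
  \<open>(s, t, u)\<close> is a nonzero multiple of \<open>v\<^sub>1\<^sup>N\<^sup>-\<^sup>s\<^sup>-\<^sup>t\<^sup>-\<^sup>u v\<^sub>2\<^sup>s v\<^sub>3\<^sup>t v\<^sub>4\<^sup>u\<close> plus monomials with a higher power of
  \<open>v\<^sub>1\<close>, and these vectors span \<open>P\<^sub>N\<close>. There are \<open>dim P\<^sub>N\<close> of them, so they form a basis.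
  Part (i) takes the variables for the \<open>v\<^sub>i\<close>, part (ii) their Hadamard transform.
\<close>

interpretation pol: vector_space pscale
  by (rule vector_space_pscale)

section \<open>Derivations on products and degrees of products\<close>

lemma derivation_prod:
  assumes "derivation D" "finite I"
  shows "D (\<Prod>i\<in>I. g i) = (\<Sum>i\<in>I. D (g i) * (\<Prod>j\<in>I - {i}. g j))"
  using assms(2)
proof (induction I rule: finite_induct)
  case empty
  show ?case by (simp add: derivationD(5)[OF assms(1)])
next
  case (insert k I)
  have "(\<Sum>i\<in>I. D (g i) * (\<Prod>j\<in>insert k I - {i}. g j)) =
      (\<Sum>i\<in>I. g k * (D (g i) * (\<Prod>j\<in>I - {i}. g j)))"
  proof (rule sum.cong)
    fix i assume "i \<in> I"
    then have "insert k I - {i} = insert k (I - {i})" using insert.hyps by auto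
    then show "D (g i) * (\<Prod>j\<in>insert k I - {i}. g j) = g k * (D (g i) * (\<Prod>j\<in>I - {i}. g j))"
      using insert.hyps by (simp add: mult_ac)
  qed simp
  then show ?case
    using insert by (simp add: derivationD(3)[OF assms(1)] sum_distrib_left)
qed

lemma derivation_power:
  assumes "derivation D"
  shows "D (p ^ n) = pscale (of_nat n) (p ^ (n - 1) * D p)"
proof (induction n)
  case 0
  show ?case by (simp add: derivationD(5)[OF assms])
next
  case (Suc n)
  \<comment> \<open>For \<open>n = 0\<close> the exponent \<open>n - 1\<close> is truncated, but the
    factor \<open>of_nat n\<close> makes both sides vanish.\<close>
  have "p * D (p ^ n) = pscale (of_nat n) (p ^ n * D p)"
    unfolding Suc by (cases n) (simp_all add: pscale_conv_mult mult_ac)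
  then show ?case
    by (simp add: derivationD(3)[OF assms] pscale_simps mult.commute)
qed

lemma homog_mult:
  assumes "p \<in> homog m" "q \<in> homog n"
  shows "p * q \<in> homog (m + n)"
proof -
  have "mdeg (a + b) = mdeg a + mdeg b" for a b
    by (simp add: mdeg_def lookup_add sum.distrib)
  then show ?thesis
    using assms keys_mult[of p q] by (fastforce simp: homog_def)
qed

lemma homog_power: "p \<in> homog m \<Longrightarrow> p ^ n \<in> homog (n * m)"
proof (induction n)
  case 0
  show ?case by (simp add: homog_def mdeg_def)
next
  case (Suc n)
  then show ?case by (simp add: homog_mult)
qed

lemma var_homog: "var i \<in> homog 1"
  by (simp add: homog_def var_def mdeg_def lookup_single when_def)

section \<open>Monomials in four forms and the filtration by the exponent of
  \<open>v 1\<close>\<close>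

definition vmono :: "(4 \<Rightarrow> pol) \<Rightarrow> (4 \<Rightarrow> nat) \<Rightarrow> pol" where
  "vmono v e = (\<Prod>i\<in>UNIV. v i ^ e i)"

lemma vmono_Suc: "vmono v (e(j := Suc (e j))) = vmono v e * v j"
proof -
  have "vmono v (e(j := k)) = v j ^ k * (\<Prod>i\<in>UNIV - {j}. v i ^ e i)" for k
    unfolding vmono_def by (subst prod.remove[of _ j]) auto
  from this[of "Suc (e j)"] this[of "e j"] show ?thesis by (simp add: mult_ac)
qed

lemma sum_fun_upd_Suc: "(\<Sum>i\<in>UNIV. (e(j := Suc (e j))) i) = Suc (\<Sum>i\<in>UNIV. e (i::4) :: nat)"
proof -
  have "(\<Sum>i\<in>UNIV. (e(j := k)) i) = k + (\<Sum>i\<in>UNIV - {j}. e i)" for k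
    by (subst sum.remove[of _ j]) auto
  from this[of "Suc (e j)"] this[of "e j"] show ?thesis by simp
qed

text \<open>Trades one factor \<open>v i\<close> for \<open>v j\<close>. The decrement comes first,
  so \<open>i = j\<close> gives back \<open>e\<close> when \<open>e i > 0\<close>; for
  \<open>e i = 0\<close> the subtraction is truncated and the degree rises by one.\<close>

definition vshift :: "4 \<Rightarrow> 4 \<Rightarrow> (4 \<Rightarrow> nat) \<Rightarrow> 4 \<Rightarrow> nat" where
  "vshift i j e = (let e' = e(i := e i - 1) in e'(j := Suc (e' j)))"

lemma sum_vshift:
  assumes "e i > 0"
  shows "(\<Sum>l\<in>UNIV. vshift i j e l) = (\<Sum>l\<in>UNIV. e l)"
proof -
  have "(\<Sum>l\<in>UNIV. e l) = (\<Sum>l\<in>UNIV. ((e(i := e i - 1))(i := Suc ((e(i := e i - 1)) i))) l)"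
    using assms by simp
  then show ?thesis unfolding vshift_def Let_def sum_fun_upd_Suc by simp
qed

text \<open>By the Leibniz rule, each of the \<open>e i\<close> factors \<open>v i\<close> is
  replaced once by its image. The ill-formed shifts with \<open>e i = 0\<close> carry coefficient
  zero.\<close>

lemma derivation_vmono:
  assumes D: "derivation D" and v: "\<And>i. D (v i) = v (\<pi> i)"
  shows "D (vmono v e) = (\<Sum>i\<in>UNIV. pscale (of_nat (e i)) (vmono v (vshift i (\<pi> i) e)))"
proof -
  have "D (v i ^ e i) * (\<Prod>j\<in>UNIV - {i}. v j ^ e j) =
      pscale (of_nat (e i)) (vmono v (vshift i (\<pi> i) e))" for i
  proof -
    have "vmono v (e(i := e i - 1)) = v i ^ (e i - 1) * (\<Prod>j\<in>UNIV - {i}. v j ^ e j)"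
      unfolding vmono_def by (subst prod.remove[of _ i]) auto
    then show ?thesis
      unfolding derivation_power[OF D] vshift_def Let_def vmono_Suc v
      by (simp add: pscale_conv_mult mult_ac)
  qed
  then show ?thesis
    unfolding vmono_def[of v e] by (subst derivation_prod[OF D]) simp_all
qed

text \<open>A filtration decreasing in \<open>a\<close>. It is a span rather than a condition on
  coefficients, because the monomials in \<open>v\<close> are not known to be independent
  here.\<close>

definition vfilt :: "(4 \<Rightarrow> pol) \<Rightarrow> nat \<Rightarrow> nat \<Rightarrow> pol set" where
  "vfilt v N a = pol.span (vmono v ` {e. (\<Sum>i\<in>UNIV. e i) = N \<and> a \<le> e 1})"

lemma vmono_in_vfilt: "(\<Sum>i\<in>UNIV. e i) = N \<Longrightarrow> a \<le> e 1 \<Longrightarrow> vmono v e \<in> vfilt v N a"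
  unfolding vfilt_def by (rule pol.span_base) blast

lemma subspace_vfilt: "pol.subspace (vfilt v N a)"
  unfolding vfilt_def by (rule pol.subspace_span)

text \<open>Replacing a factor \<open>v i\<close> with \<open>i \<noteq> 1\<close> cannot lower the
  exponent of \<open>v 1\<close>, and raises it if \<open>\<pi> i = 1\<close>. Only the subtracted
  term can leave the level \<open>e 1\<close>.\<close>

lemma derivation_vmono_filt:
  assumes D: "derivation D" and v: "\<And>i. D (v i) = v (\<pi> i)"
    and e: "(\<Sum>i\<in>UNIV. e i) = N"
  shows "D (vmono v e) - pscale (of_nat (e 1)) (vmono v (vshift 1 (\<pi> 1) e)) \<in> vfilt v N (e 1)"
proof -
  have "pscale (of_nat (e i)) (vmono v (vshift i (\<pi> i) e)) \<in> vfilt v N (e 1)" if "i \<noteq> 1" for i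
  proof (cases "e i = 0")
    case True
    then show ?thesis by (simp add: pol.subspace_0[OF subspace_vfilt])
  next
    case False
    have "e 1 \<le> vshift i (\<pi> i) e 1" using that by (simp add: vshift_def)
    then show ?thesis
      using False e
      by (intro pol.subspace_scale[OF subspace_vfilt] vmono_in_vfilt) (simp_all add: sum_vshift)
  qed
  then have "(\<Sum>i\<in>UNIV - {1}. pscale (of_nat (e i)) (vmono v (vshift i (\<pi> i) e))) \<in> vfilt v N (e 1)"
    by (intro pol.subspace_sum[OF subspace_vfilt]) simp
  then show ?thesis
    unfolding derivation_vmono[of D v \<pi>, OF D v] by (subst sum.remove[of _ 1]) simp_all
qed

lemma vfilt_mono: "a \<le> b \<Longrightarrow> vfilt v N b \<subseteq> vfilt v N a"
  unfolding vfilt_def by (intro pol.span_mono) auto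

lemma derivation_vfilt:
  assumes D: "derivation D" and v: "\<And>i. D (v i) = v (\<pi> i)" and p: "p \<in> vfilt v N (Suc a)"
  shows "D p \<in> vfilt v N a"
  using p unfolding vfilt_def[of v N "Suc a"]
proof (induction rule: pol.span_induct_alt)
  case base
  show ?case by (simp add: derivationD(4)[OF D] pol.subspace_0[OF subspace_vfilt])
next
  case (step c x y)
  then obtain e where x: "x = vmono v e" and e: "(\<Sum>i\<in>UNIV. e i) = N" "Suc a \<le> e 1" by auto
  have "D (vmono v e) - pscale (of_nat (e 1)) (vmono v (vshift 1 (\<pi> 1) e)) \<in> vfilt v N a"
    using derivation_vmono_filt[of D v \<pi>, OF D v e(1)] vfilt_mono[of a "e 1" v N] e(2) by auto
  moreover have "pscale (of_nat (e 1)) (vmono v (vshift 1 (\<pi> 1) e)) \<in> vfilt v N a"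
    using e by (intro pol.subspace_scale[OF subspace_vfilt] vmono_in_vfilt)
      (auto simp: sum_vshift, auto simp: vshift_def)
  ultimately have "D x \<in> vfilt v N a"
    unfolding x using pol.subspace_add[OF subspace_vfilt] by fastforce
  then show ?case
    unfolding derivationD(1,2)[OF D] using step
    by (intro pol.subspace_add[OF subspace_vfilt] pol.subspace_scale[OF subspace_vfilt])
qed

text \<open>The vector \<open>p\<close> has leading term a nonzero multiple of \<open>v\<^sup>e\<close>, where lower-order terms are
  those with a higher exponent of \<open>v\<^sub>1\<close>.\<close>

definition vlead :: "(4 \<Rightarrow> pol) \<Rightarrow> nat \<Rightarrow> (4 \<Rightarrow> nat) \<Rightarrow> pol \<Rightarrow> bool" where
  "vlead v N e p \<longleftrightarrow> (\<Sum>i\<in>UNIV. e i) = N \<and>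
     (\<exists>c. c \<noteq> 0 \<and> p - pscale c (vmono v e) \<in> vfilt v N (Suc (e 1)))"

text \<open>The remainder drops from level \<open>Suc (e 1)\<close> to level \<open>e 1\<close>,
  which is still one above the exponent of \<open>v 1\<close> in the new leading monomial. The
  leading coefficient is multiplied by \<open>e 1\<close>, which is nonzero.\<close>

lemma vlead_derivation:
  assumes D: "derivation D" and v: "\<And>i. D (v i) = v (\<pi> i)" and \<pi>: "\<pi> 1 \<noteq> 1"
    and p: "vlead v N e p" and pos: "e 1 > 0"
  shows "vlead v N (vshift 1 (\<pi> 1) e) (D p)"
proof -
  let ?e = "vshift 1 (\<pi> 1) e"
  obtain c where e: "(\<Sum>i\<in>UNIV. e i) = N" and c: "c \<noteq> 0"
    and r: "p - pscale c (vmono v e) \<in> vfilt v N (Suc (e 1))"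
    using p by (auto simp: vlead_def)
  have e1: "Suc (?e 1) = e 1" using \<pi> pos by (simp add: vshift_def)
  have "D (p - pscale c (vmono v e)) +
      pscale c (D (vmono v e) - pscale (of_nat (e 1)) (vmono v ?e)) \<in> vfilt v N (e 1)"
    by (intro pol.subspace_add[OF subspace_vfilt] pol.subspace_scale[OF subspace_vfilt]
        derivation_vfilt[of D v \<pi>, OF D v r] derivation_vmono_filt[of D v \<pi>, OF D v e])
  moreover have "D (p - pscale c (vmono v e)) = D p - pscale c (D (vmono v e))"
    using derivationD(1)[OF D, of "p - pscale c (vmono v e)" "pscale c (vmono v e)"]
    by (simp add: derivationD(2)[OF D])
  ultimately have "D p - pscale (c * of_nat (e 1)) (vmono v ?e) \<in> vfilt v N (e 1)"
    by (simp add: pscale_simps)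
  then show ?thesis
    unfolding vlead_def e1 using c pos e by (auto simp: sum_vshift intro!: exI[of _ "c * of_nat (e 1)"])
qed

lemma vlead_derivation_funpow:
  assumes D: "derivation D" and v: "\<And>i. D (v i) = v (\<pi> i)" and \<pi>: "\<pi> 1 \<noteq> 1"
    and p: "vlead v N e p" and "k \<le> e 1"
  shows "vlead v N (e(1 := e 1 - k, \<pi> 1 := e (\<pi> 1) + k)) ((D ^^ k) p)"
  using assms(5)
proof (induction k)
  case 0
  show ?case using p by simp
next
  case (Suc k)
  let ?e = "e(1 := e 1 - k, \<pi> 1 := e (\<pi> 1) + k)"
  have "vlead v N (vshift 1 (\<pi> 1) ?e) (D ((D ^^ k) p))"
    using Suc \<pi> by (intro vlead_derivation[of D v \<pi>, OF D v \<pi>]) (simp_all del: fun_upd_apply, simp)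
  moreover have "vshift 1 (\<pi> 1) ?e = e(1 := e 1 - Suc k, \<pi> 1 := e (\<pi> 1) + Suc k)"
    using \<pi> by (auto simp: vshift_def fun_eq_iff)
  ultimately show ?case by (simp del: fun_upd_apply)
qed

section \<open>Generators and dimension of the homogeneous part\<close>

lemma single_in_span_vmono:
  assumes "\<And>i. var i \<in> pol.span (range v)" "mdeg m = N"
  shows "Poly_Mapping.single m 1 \<in> vfilt v N 0"
  using assms(2)
proof (induction N arbitrary: m)
  case 0
  then have "m = 0" by (auto simp: mdeg_def intro!: poly_mapping_eqI)
  then show ?case using vmono_in_vfilt[of "\<lambda>_. 0" 0 0 v] by (simp add: vmono_def)
next
  case (Suc N)
  then obtain i where i: "Poly_Mapping.lookup m i \<noteq> 0"
    by (metis mdeg_def sum.neutral nat.distinct(1))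
  define n where "n = m - Poly_Mapping.single i 1"
  have m: "m = n + Poly_Mapping.single i 1"
    unfolding n_def using i
    by (intro poly_mapping_eqI) (auto simp: lookup_add lookup_minus lookup_single when_def)
  have "mdeg m = mdeg n + 1"
    unfolding m by (simp add: mdeg_def lookup_add sum.distrib lookup_single when_def)
  then have n: "Poly_Mapping.single n 1 \<in> vfilt v N 0" using Suc by simp
  have step: "p * v j \<in> vfilt v (Suc N) 0" if "p \<in> vfilt v N 0" for p j
    using that unfolding vfilt_def[of v N 0]
  proof (induction rule: pol.span_induct_alt)
    case base
    show ?case by (simp add: pol.subspace_0[OF subspace_vfilt])
  next
    case (step c x y)
    then obtain e where "x = vmono v e" "(\<Sum>i\<in>UNIV. e i) = N" by auto
    then have "x * v j \<in> vfilt v (Suc N) 0"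
      by (auto simp flip: vmono_Suc simp: sum_fun_upd_Suc intro!: vmono_in_vfilt simp del: fun_upd_apply)
    then show ?case
      using step unfolding distrib_right pscale_mult_left
      by (intro pol.subspace_add[OF subspace_vfilt] pol.subspace_scale[OF subspace_vfilt])
  qed
  have mult_v: "Poly_Mapping.single n 1 * v j \<in> vfilt v (Suc N) 0" for j
    by (rule step[OF n])
  \<comment> \<open>The product is linear in its second factor, so expanding \<open>var i\<close> in
    the forms \<open>v j\<close> reduces the claim to \<open>mult_v\<close>.\<close>
  have "Poly_Mapping.single n 1 * var i \<in> vfilt v (Suc N) 0"
    using assms(1)[of i]
  proof (induction rule: pol.span_induct_alt)
    case base
    show ?case by (simp add: pol.subspace_0[OF subspace_vfilt])
  next
    case (step c x y)
    then have "Poly_Mapping.single n 1 * x \<in> vfilt v (Suc N) 0"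
      using mult_v by auto
    moreover have "Poly_Mapping.single n 1 * pscale c x = pscale c (Poly_Mapping.single n 1 * x)"
      by (simp add: pscale_conv_mult mult_ac)
    ultimately show ?case
      using step unfolding distrib_left
      by (auto intro!: pol.subspace_add[OF subspace_vfilt] pol.subspace_scale[OF subspace_vfilt])
  qed
  then show ?case by (simp add: m var_def mult_single)
qed

lemma homog_eq_span_single:
  "homog N = pol.span ((\<lambda>m. Poly_Mapping.single m 1) ` {m. mdeg m = N})"
proof (rule antisym)
  show "homog N \<subseteq> pol.span ((\<lambda>m. Poly_Mapping.single m 1) ` {m. mdeg m = N})"
  proof
    fix p assume p: "p \<in> homog N"
    have "p = (\<Sum>m\<in>Poly_Mapping.keys p. pscale (Poly_Mapping.lookup p m) (Poly_Mapping.single m 1))"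
      by (subst pol_expand) (simp add: pscale_conv_mult mult_single)
    also have "\<dots> \<in> pol.span ((\<lambda>m. Poly_Mapping.single m 1) ` {m. mdeg m = N})"
      using p by (intro pol.span_sum pol.span_scale pol.span_base) (auto simp: homog_def)
    finally show "p \<in> pol.span ((\<lambda>m. Poly_Mapping.single m 1) ` {m. mdeg m = N})" .
  qed
  show "pol.span ((\<lambda>m. Poly_Mapping.single m 1) ` {m. mdeg m = N}) \<subseteq> homog N"
    by (intro pol.span_minimal subspace_homog) (auto simp: homog_def)
qed

text \<open>Taking the coefficient at \<open>m\<close> isolates one summand, since distinct
  monomials have disjoint supports.\<close>

lemma independent_single: "pol.independent ((\<lambda>m. Poly_Mapping.single m 1) ` M)"
  unfolding pol.independent_explicit_module
proof (intro allI impI)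
  fix T u p
  assume T: "finite T" "T \<subseteq> (\<lambda>m. Poly_Mapping.single m 1) ` M"
    and eq: "(\<Sum>q\<in>T. pscale (u q) q) = 0" and p: "p \<in> T"
  obtain m where m: "p = Poly_Mapping.single m 1" using T p by auto
  have "0 = (\<Sum>q\<in>T. u q * Poly_Mapping.lookup q m)"
    using arg_cong[OF eq, of "\<lambda>q. Poly_Mapping.lookup q m"] by (simp add: lookup_sum)
  also have "\<dots> = (\<Sum>q\<in>T. if q = p then u p else 0)"
  proof (rule sum.cong)
    fix q assume "q \<in> T"
    then obtain n where n: "q = Poly_Mapping.single n 1" using T by auto
    show "u q * Poly_Mapping.lookup q m = (if q = p then u p else 0)"
      by (cases "n = m") (auto simp: n m lookup_single dest: arg_cong[of _ _ "\<lambda>q. Poly_Mapping.lookup q m"])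
  qed simp
  also have "\<dots> = u p" using T p by simp
  finally show "u p = 0" by simp
qed

text \<open>The total degree determines the exponent of the first variable from the other three; on
  the index set the subtraction from \<open>N\<close> is not truncated.\<close>

lemma bij_betw_triples_monomials:
  "bij_betw (\<lambda>m. (Poly_Mapping.lookup m 2, Poly_Mapping.lookup m 3, Poly_Mapping.lookup m 4))
     {m. mdeg m = N} {(s, t, u). s + t + u \<le> N}"
proof (rule bij_betwI[where g = "\<lambda>(s, t, u). Poly_Mapping.single 1 (N - (s + t + u)) +
    Poly_Mapping.single 2 s + Poly_Mapping.single 3 t + Poly_Mapping.single 4 u"], goal_cases)
  case 3
  then show ?case
    by (intro poly_mapping_eqI) (use exhaust_4 in \<open>force simp: mdeg_def sum_4 lookup_add lookup_single when_def\<close>)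
qed (auto simp: mdeg_def sum_4 lookup_add lookup_single when_def)

lemma finite_triples: "finite {(s, t, u). s + t + u \<le> (N::nat)}"
  by (rule finite_subset[of _ "{..N} \<times> {..N} \<times> {..N}"]) auto

lemma dim_homog: "pol.dim (homog N) = card {(s, t, u). s + t + u \<le> N}"
proof -
  have "inj_on (\<lambda>m. Poly_Mapping.single m (1::complex)) {m. mdeg m = N}"
    by (rule inj_onI) (drule arg_cong[of _ _ Poly_Mapping.keys], simp)
  then have "card ((\<lambda>m. Poly_Mapping.single m (1::complex)) ` {m. mdeg m = N}) = card {(s, t, u). s + t + u \<le> N}"
    using bij_betw_same_card[OF bij_betw_triples_monomials] by (simp add: card_image)
  then show ?thesis
    unfolding homog_eq_span_single pol.dim_span by (simp add: pol.dim_eq_card_independent independent_single)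
qed

text \<open>The index set has exactly \<open>dim\<close> many elements, so a spanning family can
  have neither a linear relation nor a repeated value.\<close>

lemma family_basis_homog_if_spanning:
  fixes f :: "nat \<times> nat \<times> nat \<Rightarrow> pol"
  assumes "pol.span (f ` {(s, t, u). s + t + u \<le> N}) = homog N"
  shows "family_basis f {(s, t, u). s + t + u \<le> N} (homog N)"
proof -
  let ?I = "{(s, t, u). s + t + u \<le> N}"
  obtain B where B: "B \<subseteq> f ` ?I" "pol.independent B" "f ` ?I \<subseteq> pol.span B"
    using pol.maximal_independent_subset by blast
  have "pol.span B = homog N"
    using pol.span_mono[OF B(1)] pol.span_minimal[OF B(3) pol.subspace_span] assms by simp
  then have card: "card B = card ?I"
    using pol.dim_eq_card_independent[OF B(2)] pol.dim_span[of B] dim_homog by simp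
  \<comment> \<open>\<open>B\<close> lies in the image, which has at most
    \<open>card ?I = card B\<close> elements; the same squeeze then makes \<open>f\<close>
    injective.\<close>
  then have B_eq: "B = f ` ?I"
    using card_image_le[OF finite_triples, of f N] finite_triples
    by (intro card_seteq[OF _ B(1)]) auto
  then show ?thesis
    unfolding family_basis_def
    using eq_card_imp_inj_on[OF finite_triples, of f N] card B(2) assms by blast
qed

section \<open>Spanning by descent along leading terms\<close>

lemma family_basis_act:
  fixes v :: "4 \<Rightarrow> pol"
  assumes act: "\<And>i. act \<phi>1 (v i) = v (\<pi>1 i)" "\<And>i. act \<phi>2 (v i) = v (\<pi>2 i)"
      "\<And>i. act \<phi>3 (v i) = v (\<pi>3 i)"
    and \<pi>: "\<pi>1 1 = 2" "\<pi>2 1 = 3" "\<pi>3 1 = 4"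
    and v: "v 1 \<in> homog 1" "\<And>i. var i \<in> pol.span (range v)"
  shows "family_basis (\<lambda>(s, t, u). (act \<phi>1 ^^ s) ((act \<phi>2 ^^ t) ((act \<phi>3 ^^ u) (v 1 ^ N))))
     {(s, t, u). s + t + u \<le> N} (homog N)"
proof (rule family_basis_homog_if_spanning)
  let ?I = "{(s, t, u). s + t + u \<le> N}"
  let ?f = "\<lambda>(s, t, u). (act \<phi>1 ^^ s) ((act \<phi>2 ^^ t) ((act \<phi>3 ^^ u) (v 1 ^ N)))"
  have funpow: "(act \<phi> ^^ k) p \<in> homog N" if "p \<in> homog N" for \<phi> k p
    using that by (induction k) (simp_all add: act_homog)
  have "v 1 ^ N \<in> homog N" using homog_power[OF v(1), of N] by simp
  then have "?f ` ?I \<subseteq> homog N" by (auto intro: funpow)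
  then have sub: "pol.span (?f ` ?I) \<subseteq> homog N"
    by (intro pol.span_minimal subspace_homog)
  have lead: "vlead v N e (?f (e 2, e 3, e 4))" if e: "(\<Sum>i\<in>UNIV. e i) = N" for e
  proof -
    let ?e = "(\<lambda>_. 0)(1 := N)"
    have eN: "e 1 + e 2 + e 3 + e 4 = N" using e by (simp add: sum_4)
    have "vmono v ?e = v 1 ^ N"
      unfolding vmono_def by (subst prod.remove[of _ 1]) auto
    then have "vlead v N ?e (v 1 ^ N)"
      by (auto simp: vlead_def pol.subspace_0[OF subspace_vfilt] intro!: exI[of _ 1])
    \<comment> \<open>The innermost operator acts first. By \<open>eN\<close>, enough factors
      \<open>v 1\<close> remain at each of the three stages.\<close>
    from vlead_derivation_funpow[of _ v \<pi>3, OF derivation_act act(3) _ this, of "e 4"]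
    have "vlead v N (?e(1 := N - e 4, 4 := e 4)) ((act \<phi>3 ^^ e 4) (v 1 ^ N))"
      using \<pi> eN by simp
    from vlead_derivation_funpow[of _ v \<pi>2, OF derivation_act act(2) _ this, of "e 3"]
    have "vlead v N (?e(1 := N - e 4 - e 3, 4 := e 4, 3 := e 3))
        ((act \<phi>2 ^^ e 3) ((act \<phi>3 ^^ e 4) (v 1 ^ N)))"
      using \<pi> eN by (simp add: fun_upd_twist)
    from vlead_derivation_funpow[of _ v \<pi>1, OF derivation_act act(1) _ this, of "e 2"]
    have "vlead v N (?e(1 := N - e 4 - e 3 - e 2, 4 := e 4, 3 := e 3, 2 := e 2))
        (?f (e 2, e 3, e 4))"
      using \<pi> eN by (simp add: fun_upd_twist)
    moreover have "?e(1 := N - e 4 - e 3 - e 2, 4 := e 4, 3 := e 3, 2 := e 2) = e"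
    proof
      fix i
      show "(?e(1 := N - e 4 - e 3 - e 2, 4 := e 4, 3 := e 3, 2 := e 2)) i = e i"
        using exhaust_4[of i] eN by auto
    qed
    ultimately show ?thesis by simp
  qed
  have mono: "vmono v e \<in> pol.span (?f ` ?I)" if "(\<Sum>i\<in>UNIV. e i) = N" for e
    using that
  \<comment> \<open>Downward induction on the exponent of \<open>v 1\<close>: monomials with a
    higher exponent, hence the whole level \<open>Suc (e 1)\<close>, are already in the
    span.\<close>
  proof (induction "N - e 1" arbitrary: e rule: less_induct)
    case less
    have eN: "e 1 + e 2 + e 3 + e 4 = N" using less.prems by (simp add: sum_4)
    obtain c where c: "c \<noteq> 0"
      and r: "?f (e 2, e 3, e 4) - pscale c (vmono v e) \<in> vfilt v N (Suc (e 1))" (is "?p - _ \<in> _")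
      using lead[OF less.prems] unfolding vlead_def by blast
    have "vmono v e' \<in> pol.span (?f ` ?I)"
      if e': "(\<Sum>i\<in>UNIV. e' i) = N" "Suc (e 1) \<le> e' 1" for e'
    proof (rule less.hyps[OF _ e'(1)])
      have "e' 1 \<le> N" using e'(1) by (simp add: sum_4)
      then show "N - e' 1 < N - e 1" using e'(2) by linarith
    qed
    then have "vfilt v N (Suc (e 1)) \<subseteq> pol.span (?f ` ?I)"
      unfolding vfilt_def by (intro pol.span_minimal pol.subspace_span) auto
    moreover have "?p \<in> pol.span (?f ` ?I)"
      using eN by (intro pol.span_base imageI) simp
    \<comment> \<open>Subtracting the remainder from \<open>?p\<close> leaves \<open>c\<close> times
      the monomial, and \<open>c\<close> is invertible.\<close>
    ultimately have "pscale (1 / c) (?p - (?p - pscale c (vmono v e))) \<in> pol.span (?f ` ?I)"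
      using r by (blast intro: pol.span_scale[OF pol.span_diff[of ?p]])
    then show ?case using c by (simp add: pscale_simps)
  qed
  then have "vfilt v N 0 \<subseteq> pol.span (?f ` ?I)"
    unfolding vfilt_def by (intro pol.span_minimal pol.subspace_span) auto
  moreover have "homog N \<subseteq> vfilt v N 0"
    unfolding homog_eq_span_single using single_in_span_vmono[OF v(2)]
    by (intro pol.span_minimal subspace_vfilt) auto
  ultimately show "pol.span (?f ` ?I) = homog N" using sub by blast
qed

section \<open>The variables and their Hadamard transform\<close>

definition starvar :: "4 \<Rightarrow> pol" where
  "starvar i = pscale (1/2) (
     if i = 1 then xvar + yvar + zvar + wvar
     else if i = 2 then xvar + yvar - zvar - wvar
     else if i = 3 then xvar - yvar + zvar - wvar
     else xvar - yvar - zvar + wvar)"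

text \<open>The double transpositions (12)(34), (13)(24) and (14)(23), whose permutation matrices
  are \<open>A1\<close>, \<open>A2\<close> and \<open>A3\<close>.\<close>

definition swap1 :: "4 \<Rightarrow> 4" where
  "swap1 i = (if i = 1 then 2 else if i = 2 then 1 else if i = 3 then 4 else 3)"
definition swap2 :: "4 \<Rightarrow> 4" where
  "swap2 i = (if i = 1 then 3 else if i = 3 then 1 else if i = 2 then 4 else 2)"
definition swap3 :: "4 \<Rightarrow> 4" where
  "swap3 i = (if i = 1 then 4 else if i = 4 then 1 else if i = 2 then 3 else 2)"

lemma pscale_0_1 [simp]: "pscale 0 p = 0" "pscale 1 p = p"
  by (auto intro!: poly_mapping_eqI)

lemma act_A_var:
  "act A1 (var i) = var (swap1 i)" "act A2 (var i) = var (swap2 i)" "act A3 (var i) = var (swap3 i)"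
  using exhaust_4[of i]
  by (auto simp: act_var sum_4 A1_def A2_def A3_def munit_def swap1_def swap2_def swap3_def)

lemma act_minus: "act \<phi> (p - q) = act \<phi> p - act \<phi> q"
  using act_add[of \<phi> "p - q" q] by simp

text \<open>The diagonals of \<open>A1s\<close>, \<open>A2s\<close>, \<open>A3s\<close> are rows 2,
  3, 4 of the Hadamard sign matrix, and entrywise multiplication by a row permutes the rows as the
  Klein four-group.\<close>

lemma act_As_starvar:
  "act A1s (starvar i) = starvar (swap1 i)" "act A2s (starvar i) = starvar (swap2 i)"
  "act A3s (starvar i) = starvar (swap3 i)"
  using exhaust_4[of i]
  by (auto simp: starvar_def act_pscale act_add act_minus xvar_def yvar_def zvar_def wvar_def
      act_var sum_4 A1s_def A2s_def A3s_def diag4_def swap1_def swap2_def swap3_def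
      lookup_add lookup_minus algebra_simps intro!: poly_mapping_eqI)

text \<open>With the factor 1/2 the Hadamard transform is an involution, so the same formulas
  recover the variables.\<close>

lemma var_in_span_starvar: "var i \<in> pol.span (range starvar)"
proof -
  have s: "starvar j \<in> pol.span (range starvar)" for j by (intro pol.span_base) simp
  have "var i \<in> {pscale (1/2) (starvar 1 + starvar 2 + starvar 3 + starvar 4),
      pscale (1/2) (starvar 1 + starvar 2 - starvar 3 - starvar 4),
      pscale (1/2) (starvar 1 - starvar 2 + starvar 3 - starvar 4),
      pscale (1/2) (starvar 1 - starvar 2 - starvar 3 + starvar 4)}"
  proof -
    have "var 1 = pscale (1/2) (starvar 1 + starvar 2 + starvar 3 + starvar 4)"
      "var 2 = pscale (1/2) (starvar 1 + starvar 2 - starvar 3 - starvar 4)"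
      "var 3 = pscale (1/2) (starvar 1 - starvar 2 + starvar 3 - starvar 4)"
      "var 4 = pscale (1/2) (starvar 1 - starvar 2 - starvar 3 + starvar 4)"
      by (rule poly_mapping_eqI,
          simp only: starvar_def xvar_def yvar_def zvar_def wvar_def lookup_add lookup_minus lookup_pscale,
          simp add: lookup_add lookup_minus field_simps)+
    then show ?thesis using exhaust_4[of i] by blast
  qed
  then show ?thesis
    by (auto intro!: pol.span_scale pol.span_add pol.span_diff s)
qed

theorem proposition10p11:
  fixes N :: nat
  shows "family_basis
           (\<lambda>(s, t, u). (act A1 ^^ s) ((act A2 ^^ t) ((act A3 ^^ u) (xvar ^ N))))
           {(s, t, u). s + t + u \<le> N} (homog N)
       \<and> family_basis
           (\<lambda>(s, t, u). (act A1s ^^ s) ((act A2s ^^ t) ((act A3s ^^ u) (xstar ^ N))))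
           {(s, t, u). s + t + u \<le> N} (homog N)"
proof
  have "var i \<in> pol.span (range var)" for i by (intro pol.span_base) simp
  then show "family_basis
      (\<lambda>(s, t, u). (act A1 ^^ s) ((act A2 ^^ t) ((act A3 ^^ u) (xvar ^ N))))
      {(s, t, u). s + t + u \<le> N} (homog N)"
    unfolding xvar_def
    by (intro family_basis_act[of _ var swap1 _ swap2 _ swap3])
      (simp_all add: act_A_var var_homog[unfolded One_nat_def] swap1_def swap2_def swap3_def)
  have x: "xstar = starvar 1" by (simp add: xstar_def starvar_def)
  have "starvar 1 \<in> homog 1"
    unfolding starvar_def xvar_def yvar_def zvar_def wvar_def
    by (auto intro!: pol.subspace_scale[OF subspace_homog] pol.subspace_add[OF subspace_homog] pol.subspace_diff[OF subspace_homog]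
        var_homog[unfolded One_nat_def])
  then show "family_basis
      (\<lambda>(s, t, u). (act A1s ^^ s) ((act A2s ^^ t) ((act A3s ^^ u) (xstar ^ N))))
      {(s, t, u). s + t + u \<le> N} (homog N)"
    unfolding x
    by (intro family_basis_act[of _ starvar swap1 _ swap2 _ swap3] var_in_span_starvar)
      (simp_all add: act_As_starvar swap1_def swap2_def swap3_def)
qed

end
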